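(* Let $G$ and $G'$ be two (finite, simple, connected) graphs on the vertex set $\{1,\dots,n\}$ that are flip-equivalent. Then the graphical zonotopes $Z_G$ and $Z_{G'}$ have the same face vector.
   Context: Graphs are finite, simple (no loops or multiple edges) and connected. For a graph $G$ on vertex set $\{1,\dots,n\}$ with edge set $E(G)$, the graphical zonotope is the Minkowski sum of line segments $Z_G=\sum_{ij\in E(G)}[e_i,e_j]\subset\mathbb{R}^n$, where $e_1,\dots,e_n$ are the coordinate vectors of $\mathbb{R}^n$. The face vector of a polytope lists the numbers $f_i$ of its $i$-dimensional faces, for $i=0,1,2,\dots$ up to its dimension. Quadrilateral flip: let $G$ be a simple connected graph and let $v_1,v_2,v_3,v_4$ be four vertices of $G$ such that the subgraph induced by these four vertices is a $4$-cycle with edges $v_1v_2,v_2v_3,v_3v_4,v_4v_1$ together with the diagonal edge $v_2v_4$ (so $v_1v_3$ is not an edge). Suppose further that $V(G)\setminus\{v_1,v_2,v_3,v_4\}$ can be divided into four disjoint (possibly empty) sets $V_1,V_2,V_3,V_4$ such that, for every edge $uv$ of $G$ other than $v_2v_4$, both $u$ and $v$ belong to $V_i\cup\{v_i,v_{i+1}\}$ for some $i\in\{1,2,3,4\}$, where $v_5$ means $v_1$. Let $G'$ be the graph obtained from $G$ by deleting the edge $v_2v_4$ and adding the edge $v_1v_3$. The operation from $G$ to $G'$ is called a (quadrilateral) flip. Two graphs are flip-equivalent if one can be transformed into the other through a (finite) sequence of flips. *)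

theory Defs
  imports "HOL-Analysis.Analysis" "HOL-Library.Disjoint_Sets" "HOL-Library.Set_Algebras"
begin

text \<open>
  A graph on \<open>n\<close> vertices is given by its edge set: the vertex set is the whole finite index
  type \<open>'n\<close> with \<open>CARD('n) = n\<close>, and an edge \<open>uv\<close> is the unordered pair \<open>{u, v}\<close>.
  The same type indexes the coordinates of \<open>real ^ 'n\<close>.
\<close>

definition simple_graph :: "'n::finite set set \<Rightarrow> bool" where
  "simple_graph E \<longleftrightarrow> (\<forall>e\<in>E. card e = 2)"

definition connected_graph :: "'n::finite set set \<Rightarrow> bool" where
  "connected_graph E \<longleftrightarrow> (\<forall>u v. (\<lambda>a b. {a, b} \<in> E)\<^sup>*\<^sup>* u v)"

text \<open>
  The sum is the Minkowski sum of sets; for an edge \<open>e = {i, j}\<close>, the convex hull of the two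
  coordinate vectors is the segment \<open>[e\<^sub>i, e\<^sub>j]\<close>. The empty sum is \<open>{0}\<close>.
\<close>

definition graphical_zonotope :: "'n::finite set set \<Rightarrow> (real ^ 'n) set" where
  "graphical_zonotope E = (\<Sum>e\<in>E. convex hull ((\<lambda>i. axis i 1) ` e))"

text \<open>The entries are \<open>f\<^sub>0, \<dots>, f\<^sub>d\<close> with \<open>d\<close> the dimension of the polytope.\<close>

definition face_vector :: "'a::euclidean_space set \<Rightarrow> nat list" where
  "face_vector P =
     map (\<lambda>i. card {F. F face_of P \<and> aff_dim F = int i}) [0..<nat (aff_dim P + 1)]"

definition flip :: "'n::finite set set \<Rightarrow> 'n set set \<Rightarrow> bool" where
  "flip E E' \<longleftrightarrow>
     simple_graph E \<and> connected_graph E \<and>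
     (\<exists>(v :: nat \<Rightarrow> 'n) (V :: nat \<Rightarrow> 'n set).
        inj_on v {1..4} \<and> v 5 = v 1 \<and>
        {e \<in> E. e \<subseteq> v ` {1..4}} =
          {{v 1, v 2}, {v 2, v 3}, {v 3, v 4}, {v 4, v 1}, {v 2, v 4}} \<and>
        disjoint_family_on V {1..4} \<and>
        (\<Union>i\<in>{1..4}. V i) = UNIV - v ` {1..4} \<and>
        (\<forall>e\<in>E. e \<noteq> {v 2, v 4} \<longrightarrow> (\<exists>i\<in>{1..4}. e \<subseteq> V i \<union> {v i, v (i + 1)})) \<and>
        E' = insert {v 1, v 3} (E - {{v 2, v 4}}))"

text \<open>
  Flips are reversible (shift the indices of the \<open>v\<^sub>i\<close> and \<open>V\<^sub>i\<close> by one), so the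
  reflexive transitive closure is an equivalence relation on simple connected graphs.
\<close>

definition flip_equivalent :: "'n::finite set set \<Rightarrow> 'n set set \<Rightarrow> bool" where
  "flip_equivalent = flip\<^sup>*\<^sup>*"

end

theory Submission
  imports Defs
begin

text \<open>
  The nonempty faces of $Z_G$ are the sets on which a linear functional $w$ is maximal. Such a
  face depends only on the signs of $w_u - w_v$ over the edges $uv$, and its direction space is
  spanned by the $e_u - e_v$ with sign $0$. So it suffices to match the sign vectors of $G$ with
  those of $G'$ while preserving the dimension of this span.

  Both graphs are glued from four pieces along the sides of a square with a diagonal. On each
  piece the sign vector may be negated, and negation does not change the zero set. Nothing but
  the diagonal needs adjusting, except when opposite sides of the square, traversed cyclically,
  have opposite nonzero signs. In that case the signs on the second and fourth piece are negated;
  this exchanges the side patterns that leave the sign of the old diagonal free with those that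
  leave the sign of the new one free.
\<close>

section \<open>Faces of Minkowski sums exposed by linear functionals\<close>

text \<open>Being a set of maximisers, it equals \<open>S\<close> itself for \<open>w = 0\<close>;
  this case later yields the dimension of the zonotope.\<close>

definition max_face :: "'a::real_inner \<Rightarrow> 'a set \<Rightarrow> 'a set" where
  "max_face w S = {x \<in> S. \<forall>y\<in>S. w \<bullet> y \<le> w \<bullet> x}"

text \<open>Summands vary independently: replacing \<open>x i\<close> by \<open>y\<close> changes
  the value by \<open>w \<bullet> y - w \<bullet> x i\<close>, so the total is maximal exactly when
  no single summand can be improved.\<close>

lemma sum_mem_max_face_iff:
  fixes S :: "'i \<Rightarrow> 'a::real_inner set"
  assumes fin: "finite I" and x: "\<And>i. i \<in> I \<Longrightarrow> x i \<in> S i"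
  shows "sum x I \<in> max_face w (sum S I) \<longleftrightarrow> (\<forall>i\<in>I. x i \<in> max_face w (S i))"
proof
  assume L: "sum x I \<in> max_face w (sum S I)"
  show "\<forall>i\<in>I. x i \<in> max_face w (S i)"
  proof
    fix i assume i: "i \<in> I"
    have "w \<bullet> y \<le> w \<bullet> x i" if y: "y \<in> S i" for y
    proof -
      have "sum (x(i := y)) I \<in> sum S I"
        using fin x y by (auto simp: set_sum_alt)
      then have "w \<bullet> sum (x(i := y)) I \<le> w \<bullet> sum x I"
        using L by (auto simp: max_face_def)
      moreover have "sum (x(i := y)) I = y + sum x (I - {i})"
        using fin i by (simp add: sum.remove[where x = i])
      moreover have "sum x I = x i + sum x (I - {i})"
        using fin i by (simp add: sum.remove)
      ultimately show ?thesis by (simp add: inner_add_right)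
    qed
    then show "x i \<in> max_face w (S i)"
      using x i by (simp add: max_face_def)
  qed
next
  assume R: "\<forall>i\<in>I. x i \<in> max_face w (S i)"
  have "w \<bullet> sum y I \<le> w \<bullet> sum x I" if "\<forall>i\<in>I. y i \<in> S i" for y
    using R that by (simp add: inner_sum_right max_face_def sum_mono)
  then show "sum x I \<in> max_face w (sum S I)"
    using fin x by (auto simp: max_face_def set_sum_alt)
qed

lemma max_face_sum:
  fixes S :: "'i \<Rightarrow> 'a::real_inner set"
  assumes fin: "finite I"
  shows "max_face w (sum S I) = (\<Sum>i\<in>I. max_face w (S i))"
proof (intro equalityI subsetI)
  fix z assume z: "z \<in> max_face w (sum S I)"
  then obtain x where x: "z = sum x I" "\<forall>i\<in>I. x i \<in> S i"
    using fin by (auto simp: max_face_def set_sum_alt)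
  with z have "\<forall>i\<in>I. x i \<in> max_face w (S i)"
    using sum_mem_max_face_iff[OF fin, of x S w] by simp
  with x fin show "z \<in> (\<Sum>i\<in>I. max_face w (S i))"
    by (auto simp: set_sum_alt)
next
  fix z assume "z \<in> (\<Sum>i\<in>I. max_face w (S i))"
  then obtain x where x: "z = sum x I" "\<forall>i\<in>I. x i \<in> max_face w (S i)"
    using fin by (auto simp: set_sum_alt)
  then show "z \<in> max_face w (sum S I)"
    using sum_mem_max_face_iff[OF fin, of x S w] by (simp add: max_face_def)
qed

text \<open>The face of the sum determines the face of each summand: by nonemptiness, a maximiser of
  one summand can be completed to a maximiser of the sum.\<close>

lemma max_face_sum_eq_iff:
  fixes S :: "'i \<Rightarrow> 'a::real_inner set"
  assumes fin: "finite I"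
    and ne: "\<And>i w. i \<in> I \<Longrightarrow> max_face w (S i) \<noteq> {}"
  shows "max_face w (sum S I) = max_face w' (sum S I) \<longleftrightarrow>
    (\<forall>i\<in>I. max_face w (S i) = max_face w' (S i))"
proof
  have sub: "max_face a (S i) \<subseteq> max_face b (S i)"
    if eq: "max_face a (sum S I) = max_face b (sum S I)" and i: "i \<in> I" for a b i
  proof
    fix y assume y: "y \<in> max_face a (S i)"
    define x where "x j = (if j = i then y else (SOME z. z \<in> max_face a (S j)))" for j
    have x: "x j \<in> max_face a (S j)" if "j \<in> I" for j
      using y ne[OF that, of a] by (auto simp: x_def some_in_eq)
    have xS: "x j \<in> S j" if "j \<in> I" for j
      using x[OF that] by (simp add: max_face_def)
    have "sum x I \<in> max_face b (sum S I)"
      using sum_mem_max_face_iff[OF fin xS, where w = a] x eq by auto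
    then show "y \<in> max_face b (S i)"
      using sum_mem_max_face_iff[OF fin xS, where w = b] i by (auto simp: x_def)
  qed
  assume "max_face w (sum S I) = max_face w' (sum S I)"
  then show "\<forall>i\<in>I. max_face w (S i) = max_face w' (S i)"
    using sub[of w w'] sub[of w' w] by (intro ballI equalityI) auto
next
  assume "\<forall>i\<in>I. max_face w (S i) = max_face w' (S i)"
  then show "max_face w (sum S I) = max_face w' (sum S I)"
    by (simp add: max_face_sum[OF fin])
qed

text \<open>Faces of a polytope are exposed, and a supporting hyperplane that meets \<open>S\<close>
  sits at the maximum of its functional. Conversely, by compactness every functional attains its
  maximum.\<close>

lemma nonempty_face_of_polytope_iff:
  fixes S :: "'a::euclidean_space set"
  assumes S: "polytope S" "S \<noteq> {}"
  shows "F face_of S \<and> F \<noteq> {} \<longleftrightarrow> (\<exists>w. F = max_face w S)"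
proof
  assume F: "F face_of S \<and> F \<noteq> {}"
  then have "F exposed_face_of S"
    using exposed_face_of_polyhedron polytope_imp_polyhedron S by blast
  then obtain a b where ab: "S \<subseteq> {x. a \<bullet> x \<le> b}" "F = S \<inter> {x. a \<bullet> x = b}"
    by (auto simp: exposed_face_of_def)
  with F obtain z where "z \<in> S" "a \<bullet> z = b" by auto
  with ab have "F = max_face a S"
    by (force simp: max_face_def)
  then show "\<exists>w. F = max_face w S" ..
next
  assume "\<exists>w. F = max_face w S"
  then obtain w where F: "F = max_face w S" ..
  obtain z where z: "z \<in> S" "\<And>y. y \<in> S \<Longrightarrow> w \<bullet> y \<le> w \<bullet> z"
    using continuous_attains_sup[of S "\<lambda>y. w \<bullet> y"] S polytope_imp_compact[OF S(1)]
      continuous_on_inner[OF continuous_on_const continuous_on_id, of S w] by auto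
  have "F = S \<inter> {x. w \<bullet> x = w \<bullet> z}"
    using z by (force simp: F max_face_def)
  moreover have "\<dots> face_of S"
    using z polytope_imp_convex[OF S(1)] by (intro face_of_Int_supporting_hyperplane_le) auto
  ultimately show "F face_of S \<and> F \<noteq> {}"
    using z by auto
qed

lemma polytope_sum:
  fixes S :: "'i \<Rightarrow> 'a::euclidean_space set"
  assumes "finite I" "\<And>i. i \<in> I \<Longrightarrow> polytope (S i)"
  shows "polytope (sum S I)"
  using assms
proof (induction I rule: finite_induct)
  case empty
  then show ?case by (simp add: set_zero polytope_sing)
next
  case (insert i I)
  then have "polytope (S i)" "polytope (sum S I)" by auto
  then obtain A B where "finite A" "S i = convex hull A" "finite B" "sum S I = convex hull B"
    unfolding polytope_def by blast
  with insert.hyps show ?case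
    by (simp add: convex_hull_set_plus[symmetric] polytope_convex_hull finite_set_plus)
qed

text \<open>Translated by \<open>- sum a I\<close>, the sum lies in the span of the translated
  summands. It contains each of them, since the other summands can be held at their base points
  \<open>a i\<close>.\<close>

lemma aff_dim_sum:
  fixes T :: "'i \<Rightarrow> 'a::euclidean_space set"
  assumes fin: "finite I" and a: "\<And>i. i \<in> I \<Longrightarrow> a i \<in> T i"
  shows "aff_dim (sum T I) = int (dim (\<Union>i\<in>I. (\<lambda>x. x - a i) ` T i))"
proof -
  let ?D = "\<Union>i\<in>I. (\<lambda>x. x - a i) ` T i"
  let ?F = "(\<lambda>x. - sum a I + x) ` sum T I"
  have "?F \<subseteq> span ?D"
  proof
    fix z assume "z \<in> ?F"
    then obtain x where x: "\<forall>i\<in>I. x i \<in> T i" and z: "z = - sum a I + sum x I"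
      using fin by (auto simp: set_sum_alt)
    have "z = (\<Sum>i\<in>I. x i - a i)"
      by (simp add: z sum_subtractf)
    also have "\<dots> \<in> span ?D"
      using x by (intro span_sum span_base) auto
    finally show "z \<in> span ?D" .
  qed
  moreover have "?D \<subseteq> ?F"
  proof
    fix z assume "z \<in> ?D"
    then obtain i x where i: "i \<in> I" "x \<in> T i" "z = x - a i" by auto
    have "sum (a(i := x)) I \<in> sum T I"
      using fin a i by (auto simp: set_sum_alt)
    moreover have "sum (a(i := x)) I = x + sum a (I - {i})"
      using fin i by (simp add: sum.remove[where x = i])
    moreover have "sum a I = a i + sum a (I - {i})"
      using fin i by (simp add: sum.remove)
    ultimately show "z \<in> ?F"
      using i by (intro image_eqI[where x = "sum (a(i := x)) I"]) auto
  qed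
  ultimately have "dim ?F = dim ?D"
    by (metis dim_span dim_subset order_antisym)
  moreover have "sum a I \<in> sum T I"
    using fin a by (auto simp: set_sum_alt)
  ultimately show ?thesis
    by (simp add: aff_dim_eq_dim[of "sum a I"] hull_inc del: uminus_add_conv_diff)
qed

section \<open>Faces of the graphical zonotope as sign vectors\<close>

text \<open>Both orientations of an edge are recorded, so none has to be chosen. The value
  \<open>0\<close> off the edges makes equality of sign vectors a condition on edges alone.\<close>

definition sign_vector :: "'n::finite set set \<Rightarrow> real ^ 'n \<Rightarrow> 'n \<Rightarrow> 'n \<Rightarrow> real" where
  "sign_vector E w u v = (if {u, v} \<in> E then sgn (w $ u - w $ v) else 0)"

text \<open>The edge condition is separate because \<open>\<sigma>\<close> also vanishes on
  non-edges.\<close>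

definition zero_diffs :: "'n::finite set set \<Rightarrow> ('n \<Rightarrow> 'n \<Rightarrow> real) \<Rightarrow> (real ^ 'n) set" where
  "zero_diffs E \<sigma> = {axis u 1 - axis v 1 | u v. {u, v} \<in> E \<and> \<sigma> u v = 0}"

definition edge_segment :: "'n::finite set \<Rightarrow> (real ^ 'n) set" where
  "edge_segment e = convex hull ((\<lambda>i. axis i 1) ` e)"

lemma graphical_zonotope_eq: "graphical_zonotope E = sum edge_segment E"
  by (simp add: graphical_zonotope_def edge_segment_def)

lemma max_face_segment:
  fixes a b w :: "'a::real_inner"
  shows "max_face w (closed_segment a b) =
    (if w \<bullet> a < w \<bullet> b then {b} else if w \<bullet> b < w \<bullet> a then {a} else closed_segment a b)"
proof -
  have *: "w \<bullet> ((1 - u) *\<^sub>R a + u *\<^sub>R b) = w \<bullet> a + u * (w \<bullet> b - w \<bullet> a)" for u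
    by (simp add: inner_add_right algebra_simps)
  have ends: "a \<in> closed_segment a b" "b \<in> closed_segment a b" by auto
  consider "w \<bullet> a < w \<bullet> b" | "w \<bullet> b < w \<bullet> a" | "w \<bullet> a = w \<bullet> b" by linarith
  then show ?thesis
  proof cases
    case 1
    have "x = b" if "x \<in> max_face w (closed_segment a b)" for x
    proof -
      obtain u where u: "u \<le> 1" "x = (1 - u) *\<^sub>R a + u *\<^sub>R b"
        using \<open>x \<in> _\<close> by (auto simp: max_face_def in_segment)
      have "w \<bullet> b \<le> w \<bullet> x" using that ends by (simp add: max_face_def)
      then have "(1 - u) * (w \<bullet> b - w \<bullet> a) \<le> 0" using u * by (simp add: algebra_simps)
      then have "u = 1" using 1 u by (simp add: mult_le_0_iff)
      then show ?thesis using u by simp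
    qed
    moreover have "b \<in> max_face w (closed_segment a b)"
    proof -
      have "w \<bullet> y \<le> w \<bullet> b" if "y \<in> closed_segment a b" for y
      proof -
        obtain u where u: "u \<le> 1" "y = (1 - u) *\<^sub>R a + u *\<^sub>R b"
          using \<open>y \<in> _\<close> unfolding in_segment by blast
        have "0 \<le> (1 - u) * (w \<bullet> b - w \<bullet> a)" using 1 u by simp
        then show ?thesis unfolding u(2) * by (simp add: algebra_simps)
      qed
      then show ?thesis by (simp add: max_face_def)
    qed
    ultimately show ?thesis using 1 by auto
  next
    case 2
    have "x = a" if "x \<in> max_face w (closed_segment a b)" for x
    proof -
      obtain u where u: "0 \<le> u" "x = (1 - u) *\<^sub>R a + u *\<^sub>R b"
        using \<open>x \<in> _\<close> by (auto simp: max_face_def in_segment)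
      have "w \<bullet> a \<le> w \<bullet> x" using that ends by (simp add: max_face_def)
      then have "0 \<le> u * (w \<bullet> b - w \<bullet> a)" using u * by simp
      then have "u = 0" using 2 u by (simp add: zero_le_mult_iff)
      then show ?thesis using u by simp
    qed
    moreover have "a \<in> max_face w (closed_segment a b)"
    proof -
      have "w \<bullet> y \<le> w \<bullet> a" if "y \<in> closed_segment a b" for y
      proof -
        obtain u where u: "0 \<le> u" "y = (1 - u) *\<^sub>R a + u *\<^sub>R b"
          using \<open>y \<in> _\<close> unfolding in_segment by blast
        have "u * (w \<bullet> b - w \<bullet> a) \<le> 0" using 2 u by (simp add: mult_nonneg_nonpos)
        then show ?thesis unfolding u(2) * by simp
      qed
      then show ?thesis by (simp add: max_face_def)
    qed
    ultimately show ?thesis using 2 by auto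
  next
    case 3
    have const: "w \<bullet> x = w \<bullet> a" if "x \<in> closed_segment a b" for x
      using that * 3 by (auto simp: in_segment)
    have "max_face w (closed_segment a b) = closed_segment a b"
    proof (intro equalityI subsetI)
      fix x assume x: "x \<in> closed_segment a b"
      have "w \<bullet> y \<le> w \<bullet> x" if "y \<in> closed_segment a b" for y
        unfolding const[OF that] const[OF x] ..
      with x show "x \<in> max_face w (closed_segment a b)" unfolding max_face_def by blast
    qed (simp add: max_face_def)
    then show ?thesis using 3 by simp
  qed
qed

lemma max_face_edge:
  fixes w :: "real ^ 'n::finite"
  shows "max_face w (edge_segment {u, v}) =
    (if w $ u < w $ v then {axis v 1} else if w $ v < w $ u then {axis u 1}
     else closed_segment (axis u 1) (axis v 1))"
  by (simp add: edge_segment_def segment_convex_hull[symmetric] max_face_segment inner_axis)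

text \<open>The three signs correspond to the two end points and the whole segment, which are
  distinct sets when \<open>u \<noteq> v\<close>.\<close>

lemma max_face_edge_eq_iff:
  fixes w w' :: "real ^ 'n::finite"
  assumes "u \<noteq> v"
  shows "max_face w (edge_segment {u, v}) = max_face w' (edge_segment {u, v}) \<longleftrightarrow>
    sgn (w $ u - w $ v) = sgn (w' $ u - w' $ v)"
proof -
  have ne: "axis u 1 \<noteq> (axis v 1 :: real ^ 'n)"
    using assms by (simp add: axis_eq_axis)
  have "closed_segment (axis u 1) (axis v 1) \<noteq> {axis u 1 :: real ^ 'n}"
    "closed_segment (axis u 1) (axis v 1) \<noteq> {axis v 1 :: real ^ 'n}"
    using ne ends_in_segment by (metis singletonD)+
  then show ?thesis
    using ne by (auto simp: max_face_edge sgn_if)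
qed

lemma simple_graph_edgeE:
  assumes "simple_graph E" "e \<in> E"
  obtains u v where "e = {u, v}" "u \<noteq> v"
  using assms by (auto simp: simple_graph_def card_2_iff)

lemma max_face_edge_nonempty:
  assumes "simple_graph E" "e \<in> E"
  shows "max_face w (edge_segment e) \<noteq> {}"
proof -
  obtain u v where "e = {u, v}" using assms by (rule simple_graph_edgeE)
  then show ?thesis using ends_in_segment by (auto simp: max_face_edge)
qed

lemma max_face_zonotope_eq_iff:
  fixes w w' :: "real ^ 'n::finite"
  assumes "simple_graph E"
  shows "max_face w (graphical_zonotope E) = max_face w' (graphical_zonotope E) \<longleftrightarrow>
    sign_vector E w = sign_vector E w'"
proof -
  have "max_face w (graphical_zonotope E) = max_face w' (graphical_zonotope E) \<longleftrightarrow>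
    (\<forall>e\<in>E. max_face w (edge_segment e) = max_face w' (edge_segment e))"
    unfolding graphical_zonotope_eq
    by (rule max_face_sum_eq_iff) (use max_face_edge_nonempty[OF assms] in auto)
  also have "\<dots> \<longleftrightarrow> (\<forall>u v. {u, v} \<in> E \<longrightarrow> sgn (w $ u - w $ v) = sgn (w' $ u - w' $ v))"
  proof (intro iffI allI impI ballI)
    fix u v assume L: "\<forall>e\<in>E. max_face w (edge_segment e) = max_face w' (edge_segment e)"
      and e: "{u, v} \<in> E"
    then have "u \<noteq> v" using assms by (auto simp: simple_graph_def)
    with L e show "sgn (w $ u - w $ v) = sgn (w' $ u - w' $ v)"
      using max_face_edge_eq_iff by blast
  next
    fix e assume R: "\<forall>u v. {u, v} \<in> E \<longrightarrow> sgn (w $ u - w $ v) = sgn (w' $ u - w' $ v)"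
      and e: "e \<in> E"
    obtain u v where "e = {u, v}" "u \<noteq> v" using assms e by (rule simple_graph_edgeE)
    with R e show "max_face w (edge_segment e) = max_face w' (edge_segment e)"
      using max_face_edge_eq_iff by blast
  qed
  also have "\<dots> \<longleftrightarrow> sign_vector E w = sign_vector E w'"
    by (auto simp: sign_vector_def fun_eq_iff)
  finally show ?thesis .
qed

text \<open>The face is the sum of the faces of the edge segments. With an end point as base point,
  an edge of nonzero sign contributes only \<open>0\<close>, and an edge of sign \<open>0\<close>
  contributes multiples of its difference vector.\<close>

lemma aff_dim_max_face_zonotope:
  fixes w :: "real ^ 'n::finite"
  assumes E: "simple_graph E"
  shows "aff_dim (max_face w (graphical_zonotope E)) = int (dim (zero_diffs E (sign_vector E w)))"
proof -
  define T where "T e = max_face w (edge_segment e)" for e :: "'n set"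
  have "\<exists>i. i \<in> e \<and> axis i 1 \<in> T e" if e: "e \<in> E" for e
  proof -
    obtain u v where "e = {u, v}" using E e by (rule simple_graph_edgeE)
    then show ?thesis by (auto simp: T_def max_face_edge)
  qed
  then obtain i where i: "\<And>e. e \<in> E \<Longrightarrow> i e \<in> e \<and> axis (i e) 1 \<in> T e" by metis
  let ?D = "\<Union>e\<in>E. (\<lambda>x. x - axis (i e) 1) ` T e"
  let ?Z = "zero_diffs E (sign_vector E w)"
  have sub: "?D \<subseteq> span ?Z"
  proof
    fix z assume "z \<in> ?D"
    then obtain e x where e: "e \<in> E" and x: "x \<in> T e" and z: "z = x - axis (i e) 1" by auto
    obtain a b where "e = {a, b}" using E e by (rule simple_graph_edgeE)
    with i[OF e] have "e = {i e, a} \<or> e = {i e, b}" by auto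
    then obtain v where uv: "e = {i e, v}" by blast
    show "z \<in> span ?Z"
    proof (cases "w $ i e = w $ v")
      case True
      then have "x \<in> closed_segment (axis (i e) 1) (axis v 1)"
        using x uv max_face_edge[of w "i e" v] by (simp add: T_def)
      then obtain t where "x = (1 - t) *\<^sub>R axis (i e) 1 + t *\<^sub>R axis v 1"
        by (auto simp: in_segment)
      then have "z = t *\<^sub>R (axis v 1 - axis (i e) 1)"
        by (simp add: z algebra_simps)
      moreover have "axis v 1 - axis (i e) 1 \<in> ?Z"
        unfolding zero_diffs_def
        by (rule CollectI, rule exI[of _ v], rule exI[of _ "i e"])
          (use e uv True in \<open>simp add: sign_vector_def insert_commute\<close>)
      ultimately show ?thesis by (simp add: span_base span_scale)
    next
      case False
      then have "x = axis (i e) 1"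
        using x i[OF e] uv max_face_edge[of w "i e" v] by (auto simp: T_def split: if_splits)
      then show ?thesis by (simp add: z span_zero)
    qed
  qed
  have "?Z \<subseteq> span ?D"
  proof
    fix z assume "z \<in> ?Z"
    then obtain u v where uv: "{u, v} \<in> E" "w $ u = w $ v" and z: "z = axis u 1 - axis v 1"
      by (auto simp: zero_diffs_def sign_vector_def sgn_0_0 split: if_splits)
    have mem: "axis u 1 \<in> T {u, v}" "axis v 1 \<in> T {u, v}"
      using uv by (auto simp: T_def max_face_edge)
    have "axis u 1 - axis (i {u, v}) 1 \<in> ?D" "axis v 1 - axis (i {u, v}) 1 \<in> ?D"
      using mem uv by auto
    \<comment> \<open>The base point may be either end of the edge; it cancels in this
      difference.\<close>
    then have "(axis u 1 - axis (i {u, v}) 1) - (axis v 1 - axis (i {u, v}) 1) \<in> span ?D"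
      by (intro span_diff span_base)
    then show "z \<in> span ?D" by (simp add: z)
  qed
  with sub have "dim ?D = dim ?Z"
    by (meson dim_mono order_antisym)
  moreover have "aff_dim (sum T E) = int (dim ?D)"
    using i by (intro aff_dim_sum) auto
  ultimately show ?thesis
    by (simp add: graphical_zonotope_eq max_face_sum T_def[abs_def])
qed

text \<open>Faces and sign vectors are both images of the set of functionals, with the same fibres;
  this turns counting the former into counting the latter.\<close>

lemma card_image_eq_if_same_kernel:
  assumes "\<And>x y. x \<in> S \<Longrightarrow> y \<in> S \<Longrightarrow> f x = f y \<longleftrightarrow> g x = g y"
  shows "card (f ` S) = card (g ` S)"
proof (rule bij_betw_same_card)
  show "bij_betw (\<lambda>y. g (inv_into S f y)) (f ` S) (g ` S)"
  proof (rule bij_betwI')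
    fix a b assume ab: "a \<in> f ` S" "b \<in> f ` S"
    then show "g (inv_into S f a) = g (inv_into S f b) \<longleftrightarrow> a = b"
      by (metis assms f_inv_into_f inv_into_into)
  next
    fix a assume "a \<in> f ` S"
    then show "g (inv_into S f a) \<in> g ` S" by (simp add: inv_into_into)
  next
    fix b assume "b \<in> g ` S"
    then obtain x where "x \<in> S" "b = g x" by auto
    then show "\<exists>a\<in>f ` S. b = g (inv_into S f a)"
      by (metis assms f_inv_into_f imageI inv_into_into)
  qed
qed

text \<open>The covectors of the oriented matroid of the graph, graded by the dimension of the
  corresponding face.\<close>

definition covectors :: "'n::finite set set \<Rightarrow> nat \<Rightarrow> ('n \<Rightarrow> 'n \<Rightarrow> real) set" where
  "covectors E k = {\<sigma> \<in> range (sign_vector E). dim (zero_diffs E \<sigma>) = k}"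

lemma card_faces_zonotope:
  fixes E :: "'n::finite set set"
  assumes E: "simple_graph E"
  shows "card {F. F face_of graphical_zonotope E \<and> aff_dim F = int k} = card (covectors E k)"
proof -
  let ?S = "{w. dim (zero_diffs E (sign_vector E w)) = k}"
  have "edge_segment e \<noteq> {}" if "e \<in> E" for e
    using max_face_edge_nonempty[OF E that] by (auto simp: max_face_def)
  then have "\<exists>p. \<forall>e\<in>E. p e \<in> edge_segment e" by (intro bchoice) blast
  then obtain p where "\<forall>e\<in>E. p e \<in> edge_segment e" ..
  then have "graphical_zonotope E \<noteq> {}"
    by (auto simp: graphical_zonotope_eq set_sum_alt)
  moreover have "polytope (graphical_zonotope E)"
    unfolding graphical_zonotope_eq
    by (intro polytope_sum) (auto simp: edge_segment_def intro: polytope_convex_hull)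
  ultimately have faces: "F face_of graphical_zonotope E \<and> F \<noteq> {} \<longleftrightarrow>
      (\<exists>w. F = max_face w (graphical_zonotope E))" for F
    by (rule nonempty_face_of_polytope_iff[rotated])
  have "{F. F face_of graphical_zonotope E \<and> aff_dim F = int k}
      = (\<lambda>w. max_face w (graphical_zonotope E)) ` ?S" (is "?L = ?R")
  proof (intro equalityI subsetI)
    fix F assume F: "F \<in> ?L"
    \<comment> \<open>The empty face has affine dimension \<open>-1\<close>, which no natural number
      \<open>k\<close> matches.\<close>
    then have "F \<noteq> {}" by auto
    with F faces obtain w where "F = max_face w (graphical_zonotope E)" by blast
    with F show "F \<in> ?R" by (auto simp: aff_dim_max_face_zonotope[OF E])
  next
    fix F assume "F \<in> ?R"
    then show "F \<in> ?L" using faces by (auto simp: aff_dim_max_face_zonotope[OF E])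
  qed
  also have "card \<dots> = card (sign_vector E ` ?S)"
    by (rule card_image_eq_if_same_kernel) (simp add: max_face_zonotope_eq_iff[OF E])
  also have "sign_vector E ` ?S = covectors E k"
    by (auto simp: covectors_def)
  finally show ?thesis .
qed

lemma aff_dim_zonotope:
  fixes E :: "'n::finite set set"
  assumes "simple_graph E"
  shows "aff_dim (graphical_zonotope E) = int (dim (zero_diffs E (sign_vector E 0)))"
proof -
  have "max_face 0 (graphical_zonotope E) = graphical_zonotope E"
    by (auto simp: max_face_def)
  then show ?thesis
    using aff_dim_max_face_zonotope[OF assms, of 0] by simp
qed

text \<open>All entries lie in \<open>{-1, 0, 1}\<close>. Finiteness is what lets an injection
  between sets of covectors bound cardinalities.\<close>

lemma finite_covectors:
  fixes E :: "'n::finite set set"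
  shows "finite (covectors E k)"
proof -
  have "sign_vector E w u v \<in> {-1, 0, 1}" for w u v
    by (simp add: sign_vector_def sgn_if)
  then have "range (sign_vector E) \<subseteq> PiE UNIV (\<lambda>_. PiE UNIV (\<lambda>_. {-1, 0, 1}))"
    by (simp only: PiE_UNIV_domain image_subset_iff) simp
  moreover have "finite (PiE (UNIV :: 'n set) (\<lambda>_. PiE (UNIV :: 'n set) (\<lambda>_. {-1, 0, 1 :: real})))"
    by (intro finite_PiE) auto
  ultimately have "finite (range (sign_vector E))" by (rule finite_subset)
  then show ?thesis
    by (rule rev_finite_subset) (auto simp: covectors_def)
qed

section \<open>Rescaling the increments around a square\<close>

text \<open>\<open>D1\<close> to \<open>D4\<close> are the increments of a functional along the
  sides and \<open>c1\<close> to \<open>c4\<close> the factors applied to the pieces. The rescaled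
  increments must close up, and \<open>\<delta>\<close> is the sign of the new diagonal. If both
  pairs of target signs cancel with nonzero entries, this sign is free and copies that of the old
  diagonal \<open>D2 + D3\<close>; otherwise it is forced by the path through the second corner or,
  when the signs there cancel, by the path through the fourth.\<close>

lemma exists_cycle_scaling:
  fixes D1 D2 D3 D4 :: real
  assumes sum0: "D1 + D2 + D3 + D4 = 0"
    and ap: "ap \<longleftrightarrow> D1 \<noteq> 0 \<and> D2 \<noteq> 0 \<and> sgn D3 = - sgn D1 \<and> sgn D4 = - sgn D2"
    and \<tau>: "\<tau> = (if ap then -1 else 1)"
    and \<delta>: "\<delta> = (let t1 = sgn D1; t2 = \<tau> * sgn D2; t3 = sgn D3; t4 = \<tau> * sgn D4 in
        if t1 \<noteq> 0 \<and> t2 = - t1 \<and> t3 \<noteq> 0 \<and> t4 = - t3 then sgn (D2 + D3)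
        else if t1 + t2 \<noteq> 0 then sgn (t1 + t2) else - sgn (t3 + t4))"
  shows "\<exists>c1 c2 c3 c4. c1 > 0 \<and> c3 > 0 \<and> \<tau> * c2 > 0 \<and> \<tau> * c4 > 0 \<and>
    c1 * D1 + c2 * D2 + c3 * D3 + c4 * D4 = 0 \<and> sgn (c1 * D1 + c2 * D2) = \<delta>"
proof -
  \<comment> \<open>Replace each \<open>D\<^sub>i\<close> by its target sign; shifting the first two by \<open>e\<close> and the last two by
    \<open>-e\<close> keeps the sum and sets the sign of the diagonal.\<close>
  define t1 t2 t3 t4 where t: "t1 = sgn D1" "t2 = \<tau> * sgn D2" "t3 = sgn D3" "t4 = \<tau> * sgn D4"
  have scaled: ?thesis
    if nz: "D1 \<noteq> 0" "D2 \<noteq> 0" "D3 \<noteq> 0" "D4 \<noteq> 0"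
      and e: "\<bar>e\<bar> < 1" "t1 + t2 + t3 + t4 = 0" "sgn (t1 + t2 + 2 * e) = \<delta>" for e
  proof -
    define c1 c2 c3 c4 where c: "c1 = (t1 + e) / D1" "c2 = (t2 + e) / D2"
      "c3 = (t3 - e) / D3" "c4 = (t4 - e) / D4"
    have "c1 > 0" "c3 > 0" "\<tau> * c2 > 0" "\<tau> * c4 > 0"
      using nz e(1) by (auto simp: c t \<tau> sgn_if field_simps)
    moreover have cD: "c1 * D1 = t1 + e" "c2 * D2 = t2 + e" "c3 * D3 = t3 - e" "c4 * D4 = t4 - e"
      using nz by (simp_all add: c)
    have "c1 * D1 + c2 * D2 + c3 * D3 + c4 * D4 = 0" "sgn (c1 * D1 + c2 * D2) = \<delta>"
      unfolding cD using e by (auto simp: algebra_simps)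
    ultimately show ?thesis by blast
  qed
  consider (free) "t1 \<noteq> 0" "t2 = - t1" "t3 \<noteq> 0" "t4 = - t3"
    | (forced) "ap" "\<not> (t1 \<noteq> 0 \<and> t2 = - t1 \<and> t3 \<noteq> 0 \<and> t4 = - t3)"
    | (unchanged) "\<not> ap" "\<not> (t1 \<noteq> 0 \<and> t2 = - t1 \<and> t3 \<noteq> 0 \<and> t4 = - t3)"
    by blast
  then show ?thesis
  proof cases
    case free
    have nz: "D1 \<noteq> 0" "D2 \<noteq> 0" "D3 \<noteq> 0" "D4 \<noteq> 0"
      using free by (auto simp: t sgn_if \<tau>)
    have "\<delta> = sgn (D2 + D3)" using free \<delta> by (simp add: t)
    \<comment> \<open>Here \<open>t1 + t2 = 0\<close>, so the shift alone decides the sign of the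
      diagonal; halving keeps it smaller than the increments.\<close>
    then show ?thesis
      using free by (intro scaled[OF nz, of "sgn (D2 + D3) / 2"]) (auto simp: sgn_if)
  next
    case forced
    then have nz: "D1 \<noteq> 0" "D2 \<noteq> 0" "D3 \<noteq> 0" "D4 \<noteq> 0" using ap by (auto simp: sgn_if split: if_splits)
    \<comment> \<open>Antipodal signs cancel in opposite pairs, also after negating the second and
      fourth, so the target signs close up without any shift.\<close>
    have "t1 + t2 + t3 + t4 = 0" "t1 + t2 \<noteq> 0"
      using forced ap by (auto simp: t \<tau> sgn_if split: if_splits)
    moreover have "\<delta> = sgn (t1 + t2)"
      using calculation forced \<delta> unfolding t[symmetric] Let_def by auto
    ultimately show ?thesis
      by (intro scaled[OF nz, of 0]) auto
  next
    case unchanged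
    \<comment> \<open>No piece is negated and the diagonal is forced, so all factors can be
      \<open>1\<close>.\<close>
    have "\<tau> = 1" using unchanged \<tau> by simp
    have "\<delta> = (if t1 + t2 \<noteq> 0 then sgn (t1 + t2) else - sgn (t3 + t4))"
      using \<delta> unchanged(2) unfolding t[symmetric] Let_def by auto
    then have "sgn (D1 + D2) = \<delta>"
      using unchanged sum0 by (auto simp: t \<open>\<tau> = 1\<close> ap sgn_if split: if_splits)
    then show ?thesis
      using sum0 \<open>\<tau> = 1\<close>
      by (intro exI[of _ 1]) simp
  qed
qed

text \<open>Under the hypothesis the two orientations of the new edge enter together; the second, a
  negative of the first, adds nothing to the span.\<close>

lemma dim_zero_diffs_insert:
  fixes H :: "'n::finite set set"
  assumes "\<sigma> p q = 0 \<longleftrightarrow> \<sigma> q p = 0"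
  shows "dim (zero_diffs (insert {p, q} H) \<sigma>) =
    (if \<sigma> p q = 0 \<and> axis p 1 - axis q 1 \<notin> span (zero_diffs H \<sigma>)
     then dim (zero_diffs H \<sigma>) + 1 else dim (zero_diffs H \<sigma>))"
proof (cases "\<sigma> p q = 0")
  case True
  let ?d = "axis p 1 - axis q 1 :: real ^ 'n"
  have "zero_diffs (insert {p, q} H) \<sigma> = insert (- ?d) (insert ?d (zero_diffs H \<sigma>))"
    using True assms by (auto simp: zero_diffs_def doubleton_eq_iff)
  moreover have "- ?d \<in> span (insert ?d (zero_diffs H \<sigma>))"
    by (intro span_neg span_base) simp
  ultimately show ?thesis
    using True by (simp add: dim_insert)
next
  case False
  then have "zero_diffs (insert {p, q} H) \<sigma> = zero_diffs H \<sigma>"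
    using assms by (auto simp: zero_diffs_def doubleton_eq_iff)
  then show ?thesis using False by simp
qed

section \<open>Four pieces glued around a square\<close>

text \<open>\<open>H\<close> is the common part of the two graphs, each of which is \<open>H\<close>
  with one diagonal. Leaving the diagonals out makes the setting symmetric under rotation of the
  square.\<close>

locale flip_square =
  fixes H :: "'n::finite set set" and v1 v2 v3 v4 :: 'n and P1 P2 P3 P4 :: "'n set"
  assumes distinct: "distinct [v1, v2, v3, v4]"
    and sides: "{v1, v2} \<in> H" "{v2, v3} \<in> H" "{v3, v4} \<in> H" "{v4, v1} \<in> H"
    and meet: "P1 \<inter> P2 = {v2}" "P2 \<inter> P3 = {v3}" "P3 \<inter> P4 = {v4}" "P4 \<inter> P1 = {v1}"
      "P1 \<inter> P3 = {}" "P2 \<inter> P4 = {}"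
    and edges: "\<And>e. e \<in> H \<Longrightarrow> card e = 2 \<and> (e \<subseteq> P1 \<or> e \<subseteq> P2 \<or> e \<subseteq> P3 \<or> e \<subseteq> P4)"
begin

text \<open>Rotation by one corner exchanges the two diagonals, so every inequality between the two
  graphs also yields its converse.\<close>

lemma rotate: "flip_square H v2 v3 v4 v1 P2 P3 P4 P1"
proof
  show "card e = 2 \<and> (e \<subseteq> P2 \<or> e \<subseteq> P3 \<or> e \<subseteq> P4 \<or> e \<subseteq> P1)" if "e \<in> H" for e
    using edges[OF that] by blast
qed (use distinct sides meet in \<open>auto simp: Int_commute\<close>)

lemma sides_swapped: "{v2, v1} \<in> H" "{v3, v2} \<in> H" "{v4, v3} \<in> H" "{v1, v4} \<in> H"
  using sides by (simp_all add: insert_commute)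

lemma corners: "v1 \<in> P4" "v1 \<in> P1" "v2 \<in> P1" "v2 \<in> P2" "v3 \<in> P2" "v3 \<in> P3" "v4 \<in> P3" "v4 \<in> P4"
  using meet by auto

text \<open>Opposite corners lie in no common piece.\<close>

lemma diagonals_notin: "{v2, v4} \<notin> H" "{v1, v3} \<notin> H"
  using edges[of "{v2, v4}"] edges[of "{v1, v3}"] corners meet distinct by auto

text \<open>The pieces are treated one after another, each adjusted by a constant to agree with the
  previous one at their common corner. The hypothesis says that the fourth again agrees with the
  first at \<open>v1\<close>.\<close>

lemma rescale:
  fixes w :: "real ^ 'n"
  assumes "c1 * (w $ v2 - w $ v1) + c2 * (w $ v3 - w $ v2) + c3 * (w $ v4 - w $ v3) + c4 * (w $ v1 - w $ v4) = 0"
  obtains w' :: "real ^ 'n"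
  where "\<And>x y. x \<in> P1 \<Longrightarrow> y \<in> P1 \<Longrightarrow> w' $ x - w' $ y = c1 * (w $ x - w $ y)"
    and "\<And>x y. x \<in> P2 \<Longrightarrow> y \<in> P2 \<Longrightarrow> w' $ x - w' $ y = c2 * (w $ x - w $ y)"
    and "\<And>x y. x \<in> P3 \<Longrightarrow> y \<in> P3 \<Longrightarrow> w' $ x - w' $ y = c3 * (w $ x - w $ y)"
    and "\<And>x y. x \<in> P4 \<Longrightarrow> y \<in> P4 \<Longrightarrow> w' $ x - w' $ y = c4 * (w $ x - w $ y)"
proof -
  define f1 where "f1 x = c1 * (w $ x - w $ v1)" for x
  define f2 where "f2 x = f1 v2 + c2 * (w $ x - w $ v2)" for x
  define f3 where "f3 x = f2 v3 + c3 * (w $ x - w $ v3)" for x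
  define f4 where "f4 x = f3 v4 + c4 * (w $ x - w $ v4)" for x
  define w' :: "real ^ 'n" where
    "w' = (\<chi> x. if x \<in> P1 then f1 x else if x \<in> P2 then f2 x else if x \<in> P3 then f3 x else f4 x)"
  have agree: "f1 v2 = f2 v2" "f2 v3 = f3 v3" "f3 v4 = f4 v4" "f4 v1 = f1 v1"
    using assms by (simp_all add: f4_def f3_def f2_def f1_def)
  have w1: "w' $ x = f1 x" if "x \<in> P1" for x
    using that by (simp add: w'_def)
  have w2: "w' $ x = f2 x" if "x \<in> P2" for x
    using that agree meet by (auto simp: w'_def set_eq_iff)
  have w3: "w' $ x = f3 x" if "x \<in> P3" for x
  proof -
    have "x \<notin> P1" "x \<in> P2 \<Longrightarrow> x = v3" using that meet by auto
    then show ?thesis using that agree by (auto simp: w'_def)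
  qed
  have w4: "w' $ x = f4 x" if "x \<in> P4" for x
  proof -
    have "x \<notin> P2" "x \<in> P3 \<Longrightarrow> x = v4" "x \<in> P1 \<Longrightarrow> x = v1" using that meet by auto
    then show ?thesis using that agree by (auto simp: w'_def)
  qed
  show thesis
  proof (rule that[of w'])
    fix x y
    show "w' $ x - w' $ y = c1 * (w $ x - w $ y)" if "x \<in> P1" "y \<in> P1"
      unfolding w1[OF that(1)] w1[OF that(2)] by (simp add: f1_def algebra_simps)
    show "w' $ x - w' $ y = c2 * (w $ x - w $ y)" if "x \<in> P2" "y \<in> P2"
      unfolding w2[OF that(1)] w2[OF that(2)] by (simp add: f2_def algebra_simps)
    show "w' $ x - w' $ y = c3 * (w $ x - w $ y)" if "x \<in> P3" "y \<in> P3"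
      unfolding w3[OF that(1)] w3[OF that(2)] by (simp add: f3_def algebra_simps)
    show "w' $ x - w' $ y = c4 * (w $ x - w $ y)" if "x \<in> P4" "y \<in> P4"
      unfolding w4[OF that(1)] w4[OF that(2)] by (simp add: f4_def algebra_simps)
  qed
qed

section \<open>The map on sign vectors\<close>

text \<open>
  Signs are read along the cycle $v_1, v_2, v_3, v_4, v_1$, so that the side of the piece \<open>P1\<close>
  has sign \<open>\<sigma> v2 v1\<close> and the side of \<open>P4\<close> has sign \<open>\<sigma> v1 v4\<close>.
\<close>

definition antipodal :: "('n \<Rightarrow> 'n \<Rightarrow> real) \<Rightarrow> bool" where
  "antipodal \<sigma> \<longleftrightarrow> \<sigma> v2 v1 \<noteq> 0 \<and> \<sigma> v3 v2 \<noteq> 0 \<and> \<sigma> v4 v3 = - \<sigma> v2 v1 \<and> \<sigma> v1 v4 = - \<sigma> v3 v2"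

text \<open>The sign of the factor with which the piece containing \<open>e\<close> is
  rescaled.\<close>

definition turn :: "('n \<Rightarrow> 'n \<Rightarrow> real) \<Rightarrow> 'n set \<Rightarrow> real" where
  "turn \<sigma> e = (if antipodal \<sigma> \<and> (e \<subseteq> P2 \<or> e \<subseteq> P4) then -1 else 1)"

text \<open>The value \<delta> of \<open>exists_cycle_scaling\<close>, read off from signs alone:
  \<sigma> at \<open>v4 v2\<close> is the old diagonal, and \<open>t1\<close> to \<open>t4\<close>
  are the side signs after the possible negation.\<close>

definition new_diagonal :: "('n \<Rightarrow> 'n \<Rightarrow> real) \<Rightarrow> real" where
  "new_diagonal \<sigma> =
    (let \<tau> = (if antipodal \<sigma> then -1 else 1);
         t1 = \<sigma> v2 v1; t2 = \<tau> * \<sigma> v3 v2; t3 = \<sigma> v4 v3; t4 = \<tau> * \<sigma> v1 v4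
     in if t1 \<noteq> 0 \<and> t2 = - t1 \<and> t3 \<noteq> 0 \<and> t4 = - t3 then \<sigma> v4 v2
        else if t1 + t2 \<noteq> 0 then sgn (t1 + t2) else - sgn (t3 + t4))"

text \<open>The diagonal value is placed at \<open>v3 v1\<close> because the first two increments
  add up to the difference from \<open>v1\<close> to \<open>v3\<close>.\<close>

definition flip_sign :: "('n \<Rightarrow> 'n \<Rightarrow> real) \<Rightarrow> 'n \<Rightarrow> 'n \<Rightarrow> real" where
  "flip_sign \<sigma> u v =
    (if {u, v} \<in> H then turn \<sigma> {u, v} * \<sigma> u v
     else if u = v3 \<and> v = v1 then new_diagonal \<sigma>
     else if u = v1 \<and> v = v3 then - new_diagonal \<sigma> else 0)"

abbreviation "E \<equiv> insert {v2, v4} H"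
abbreviation "E' \<equiv> insert {v1, v3} H"

lemma sign_sides:
  "sign_vector E w v2 v1 = sgn (w $ v2 - w $ v1)" "sign_vector E w v3 v2 = sgn (w $ v3 - w $ v2)"
  "sign_vector E w v4 v3 = sgn (w $ v4 - w $ v3)" "sign_vector E w v1 v4 = sgn (w $ v1 - w $ v4)"
  "sign_vector E w v4 v2 = sgn (w $ v4 - w $ v2)"
  using sides_swapped by (simp_all add: sign_vector_def insert_commute)

lemma turn_simps:
  "turn \<sigma> {v2, v1} = 1" "turn \<sigma> {v4, v3} = 1"
  "turn \<sigma> {v3, v2} = (if antipodal \<sigma> then -1 else 1)"
  "turn \<sigma> {v1, v4} = (if antipodal \<sigma> then -1 else 1)"
proof -
  have "v1 \<notin> P2" "v2 \<notin> P4" "v4 \<notin> P2" "v3 \<notin> P4"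
    using corners meet by auto
  then show "turn \<sigma> {v2, v1} = 1" "turn \<sigma> {v4, v3} = 1"
    "turn \<sigma> {v3, v2} = (if antipodal \<sigma> then -1 else 1)"
    "turn \<sigma> {v1, v4} = (if antipodal \<sigma> then -1 else 1)"
    using corners by (auto simp: turn_def)
qed

text \<open>The factors from \<open>exists_cycle_scaling\<close> close up, so \<open>rescale\<close>
  turns them into a functional that realises the new signs.\<close>

lemma flip_sign_covector:
  fixes w :: "real ^ 'n"
  shows "flip_sign (sign_vector E w) \<in> range (sign_vector E')"
proof -
  let ?\<sigma> = "sign_vector E w"
  define D1 D2 D3 D4 where D: "D1 = w $ v2 - w $ v1" "D2 = w $ v3 - w $ v2"
    "D3 = w $ v4 - w $ v3" "D4 = w $ v1 - w $ v4"
  define \<tau> :: real where "\<tau> = (if antipodal ?\<sigma> then -1 else 1)"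
  have s: "?\<sigma> v2 v1 = sgn D1" "?\<sigma> v3 v2 = sgn D2" "?\<sigma> v4 v3 = sgn D3" "?\<sigma> v1 v4 = sgn D4"
    "?\<sigma> v4 v2 = sgn (D2 + D3)"
    by (simp_all add: sign_sides D)
  have ap: "antipodal ?\<sigma> \<longleftrightarrow> D1 \<noteq> 0 \<and> D2 \<noteq> 0 \<and> sgn D3 = - sgn D1 \<and> sgn D4 = - sgn D2"
    by (simp add: antipodal_def s sgn_0_0)
  have diag: "new_diagonal ?\<sigma> =
      (let t1 = sgn D1; t2 = \<tau> * sgn D2; t3 = sgn D3; t4 = \<tau> * sgn D4 in
        if t1 \<noteq> 0 \<and> t2 = - t1 \<and> t3 \<noteq> 0 \<and> t4 = - t3 then sgn (D2 + D3)
        else if t1 + t2 \<noteq> 0 then sgn (t1 + t2) else - sgn (t3 + t4))"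
    unfolding new_diagonal_def s Let_def \<tau>_def[symmetric] ..
  have "D1 + D2 + D3 + D4 = 0" by (simp add: D)
  from exists_cycle_scaling[OF this ap \<tau>_def diag]
  obtain c1 c2 c3 c4 where c: "c1 > 0" "c3 > 0" "\<tau> * c2 > 0" "\<tau> * c4 > 0"
    "c1 * D1 + c2 * D2 + c3 * D3 + c4 * D4 = 0" "sgn (c1 * D1 + c2 * D2) = new_diagonal ?\<sigma>"
    by blast
  obtain w' :: "real ^ 'n"
    where w1: "\<And>x y. x \<in> P1 \<Longrightarrow> y \<in> P1 \<Longrightarrow> w' $ x - w' $ y = c1 * (w $ x - w $ y)"
      and w2: "\<And>x y. x \<in> P2 \<Longrightarrow> y \<in> P2 \<Longrightarrow> w' $ x - w' $ y = c2 * (w $ x - w $ y)"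
      and w3: "\<And>x y. x \<in> P3 \<Longrightarrow> y \<in> P3 \<Longrightarrow> w' $ x - w' $ y = c3 * (w $ x - w $ y)"
      and w4: "\<And>x y. x \<in> P4 \<Longrightarrow> y \<in> P4 \<Longrightarrow> w' $ x - w' $ y = c4 * (w $ x - w $ y)"
    by (rule rescale[OF c(5)[unfolded D]]) blast
  have sgn_c: "sgn c1 = 1" "sgn c3 = 1" "sgn c2 = \<tau>" "sgn c4 = \<tau>"
    using c(1-4) by (auto simp: \<tau>_def split: if_splits)
  have diag': "sgn (w' $ v3 - w' $ v1) = new_diagonal ?\<sigma>"
  proof -
    have "w' $ v3 - w' $ v1 = (w' $ v2 - w' $ v1) + (w' $ v3 - w' $ v2)" by simp
    also have "\<dots> = c1 * D1 + c2 * D2" using w1 w2 corners by (simp add: D)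
    finally show ?thesis using c(6) by simp
  qed
  have "flip_sign ?\<sigma> u v = sign_vector E' w' u v" for u v
  proof (cases "{u, v} \<in> H")
    case True
    then have "u \<noteq> v" using edges by force
    \<comment> \<open>Two pieces share at most one vertex, so an edge lies in only one piece; hence
      \<open>turn\<close> cannot negate an edge of \<open>P1\<close> or \<open>P3\<close>.\<close>
    then have one: "\<not> ({u, v} \<subseteq> A \<and> {u, v} \<subseteq> B)" if "A \<inter> B = {x} \<or> A \<inter> B = {}" for A B x
      using that by (metis IntI empty_iff insert_subset singletonD)
    have "sgn (w' $ u - w' $ v) = turn ?\<sigma> {u, v} * sgn (w $ u - w $ v)"
    proof -
      consider "{u, v} \<subseteq> P1" | "{u, v} \<subseteq> P2" | "{u, v} \<subseteq> P3" | "{u, v} \<subseteq> P4"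
        using edges[OF True] by blast
      then show ?thesis
      proof cases
        case 1
        then have "turn ?\<sigma> {u, v} = 1"
          using one meet unfolding turn_def by (metis Int_commute)
        then show ?thesis using 1 w1[of u v] by (simp add: sgn_mult sgn_c)
      next
        case 2
        then have "turn ?\<sigma> {u, v} = \<tau>" by (simp add: turn_def \<tau>_def)
        then show ?thesis using 2 w2[of u v] by (simp add: sgn_mult sgn_c)
      next
        case 3
        then have "turn ?\<sigma> {u, v} = 1"
          using one meet unfolding turn_def by (metis Int_commute)
        then show ?thesis using 3 w3[of u v] by (simp add: sgn_mult sgn_c)
      next
        case 4
        then have "turn ?\<sigma> {u, v} = \<tau>" by (simp add: turn_def \<tau>_def)
        then show ?thesis using 4 w4[of u v] by (simp add: sgn_mult sgn_c)
      qed
    qed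
    then show ?thesis using True by (simp add: flip_sign_def sign_vector_def)
  next
    case False
    have "sgn (w' $ v1 - w' $ v3) = - new_diagonal ?\<sigma>"
      using diag' by (metis minus_diff_eq sgn_minus)
    then show ?thesis
      using False diag' distinct by (auto simp: flip_sign_def sign_vector_def doubleton_eq_iff)
  qed
  then have "flip_sign ?\<sigma> = sign_vector E' w'" by blast
  then show ?thesis by blast
qed

text \<open>These side signs leave the old diagonal free. If the first two agree, the pattern is
  antipodal and the negation frees the new diagonal; if they differ, the signs alternate and both
  diagonals are free already.\<close>

lemma new_diagonal_free:
  assumes "\<sigma> v2 v1 \<in> {-1, 1}" "\<sigma> v3 v2 \<in> {-1, 1}" "\<sigma> v4 v3 = - \<sigma> v3 v2" "\<sigma> v1 v4 = - \<sigma> v2 v1"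
  shows "new_diagonal \<sigma> = \<sigma> v4 v2"
  using assms by (auto simp: new_diagonal_def antipodal_def)

text \<open>With nonzero sides a forced value is nonzero, so \<open>0\<close> can only be copied
  from the old diagonal.\<close>

lemma new_diagonal_eq_0:
  assumes "\<sigma> v2 v1 \<in> {-1, 1}" "\<sigma> v3 v2 \<in> {-1, 1}" "\<sigma> v4 v3 \<in> {-1, 1}" "\<sigma> v1 v4 \<in> {-1, 1}"
    and "new_diagonal \<sigma> = 0"
  shows "\<sigma> v4 v2 = 0"
  using assms by (auto simp: new_diagonal_def antipodal_def)

text \<open>A vanishing side excludes both the antipodal and the free case, so \<open>0\<close>
  means that both paths between \<open>v1\<close> and \<open>v3\<close> have cancelling
  signs.\<close>

lemma new_diagonal_eq_0_if_side_0:
  assumes "\<sigma> v2 v1 = 0 \<or> \<sigma> v3 v2 = 0 \<or> \<sigma> v4 v3 = 0 \<or> \<sigma> v1 v4 = 0"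
    and "new_diagonal \<sigma> = 0"
  shows "\<sigma> v3 v2 = - \<sigma> v2 v1 \<and> \<sigma> v1 v4 = - \<sigma> v4 v3"
proof -
  have "\<not> antipodal \<sigma>" using assms(1) by (auto simp: antipodal_def)
  then show ?thesis
    using assms by (auto simp: new_diagonal_def sgn_0_0 Let_def split: if_splits)
qed

section \<open>Injectivity of the map\<close>

text \<open>The image shows whether pieces were negated, so the signs on \<open>H\<close> can be
  recovered. The old diagonal is then either copied into the new one or determined by the
  sides.\<close>

lemma flip_sign_inj: "inj_on flip_sign (range (sign_vector E))"
proof (rule inj_onI, elim rangeE, clarify)
  fix w w' :: "real ^ 'n"
  let ?\<sigma> = "sign_vector E w" and ?\<rho> = "sign_vector E w'"
  assume eq: "flip_sign ?\<sigma> = flip_sign ?\<rho>"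
  have H: "turn ?\<sigma> {u, v} * ?\<sigma> u v = turn ?\<rho> {u, v} * ?\<rho> u v" if "{u, v} \<in> H" for u v
    using fun_cong[OF fun_cong[OF eq, of u], of v] that by (simp add: flip_sign_def)
  have s1: "?\<sigma> v2 v1 = ?\<rho> v2 v1" and s3: "?\<sigma> v4 v3 = ?\<rho> v4 v3"
    and s2: "(if antipodal ?\<sigma> then -1 else 1) * ?\<sigma> v3 v2 = (if antipodal ?\<rho> then -1 else 1) * ?\<rho> v3 v2"
    and s4: "(if antipodal ?\<sigma> then -1 else 1) * ?\<sigma> v1 v4 = (if antipodal ?\<rho> then -1 else 1) * ?\<rho> v1 v4"
    using H[OF sides_swapped(1)] H[OF sides_swapped(3)] H[OF sides_swapped(2)] H[OF sides_swapped(4)]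
    unfolding turn_simps by simp_all
  \<comment> \<open>Negating the second and fourth sides preserves antipodality.\<close>
  have ap: "antipodal ?\<sigma> \<longleftrightarrow> antipodal ?\<rho>"
    using s1 s2 s3 s4 unfolding antipodal_def by (auto split: if_splits)
  then have turn: "turn ?\<sigma> e = turn ?\<rho> e" "turn ?\<sigma> e \<noteq> 0" for e
    by (simp_all add: turn_def)
  then have onH: "?\<sigma> u v = ?\<rho> u v" if "{u, v} \<in> H" for u v
    using H[OF that] by simp
  then have s: "?\<sigma> v2 v1 = ?\<rho> v2 v1" "?\<sigma> v3 v2 = ?\<rho> v3 v2" "?\<sigma> v4 v3 = ?\<rho> v4 v3" "?\<sigma> v1 v4 = ?\<rho> v1 v4"
    using sides_swapped by simp_all
  have "flip_sign ?\<sigma> v3 v1 = flip_sign ?\<rho> v3 v1" using eq by simp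
  then have new: "new_diagonal ?\<sigma> = new_diagonal ?\<rho>"
    using diagonals_notin by (simp add: flip_sign_def insert_commute)
  have diag: "?\<sigma> v4 v2 = ?\<rho> v4 v2"
  proof (cases "?\<sigma> v2 v1 \<noteq> 0 \<and> ?\<sigma> v3 v2 \<noteq> 0 \<and> ?\<sigma> v4 v3 = - ?\<sigma> v3 v2 \<and> ?\<sigma> v1 v4 = - ?\<sigma> v2 v1")
    case True
    then have "?\<sigma> v2 v1 \<in> {-1, 1}" "?\<sigma> v3 v2 \<in> {-1, 1}"
      by (simp_all add: sign_sides sgn_if split: if_splits)
    with True s new_diagonal_free[of ?\<sigma>] new_diagonal_free[of ?\<rho>] new show ?thesis
      by simp
  next
    case False
    define D1 D2 D3 D4 where D: "D1 = w $ v2 - w $ v1" "D2 = w $ v3 - w $ v2"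
      "D3 = w $ v4 - w $ v3" "D4 = w $ v1 - w $ v4"
    define F1 F2 F3 F4 where F: "F1 = w' $ v2 - w' $ v1" "F2 = w' $ v3 - w' $ v2"
      "F3 = w' $ v4 - w' $ v3" "F4 = w' $ v1 - w' $ v4"
    have "D1 + D2 + D3 + D4 = 0" "F1 + F2 + F3 + F4 = 0" by (simp_all add: D F)
    moreover have "sgn D1 = sgn F1" "sgn D2 = sgn F2" "sgn D3 = sgn F3" "sgn D4 = sgn F4"
      using s unfolding sign_sides D F by auto
    moreover have "\<not> (sgn D1 \<noteq> 0 \<and> sgn D2 \<noteq> 0 \<and> sgn D3 = - sgn D2 \<and> sgn D4 = - sgn D1)"
      using False unfolding sign_sides D by auto
    \<comment> \<open>Outside the free pattern the side signs fix the sign of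
      \<open>D2 + D3\<close>, either directly or through
      \<open>D2 + D3 = - (D1 + D4)\<close>.\<close>
    ultimately have "sgn (D2 + D3) = sgn (F2 + F3)"
      by (auto simp: sgn_if split: if_splits)
    then show ?thesis by (simp add: sign_sides D F)
  qed
  have "sign_vector E x v2 v4 = - sign_vector E x v4 v2" for x :: "real ^ 'n"
    by (simp add: sign_vector_def insert_commute) (metis minus_diff_eq sgn_minus)
  with diag have diag': "?\<sigma> v2 v4 = ?\<rho> v2 v4" by simp
  show "?\<sigma> = ?\<rho>"
  proof (intro ext)
    fix u v show "?\<sigma> u v = ?\<rho> u v"
    proof (cases "{u, v} \<in> E")
      case True
      then consider "{u, v} \<in> H" | "u = v2" "v = v4" | "u = v4" "v = v2"
        by (auto simp: doubleton_eq_iff)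
      then show ?thesis using onH diag diag' by cases auto
    qed (simp add: sign_vector_def)
  qed
qed

section \<open>Preservation of the face dimension\<close>

text \<open>Rescaling pieces keeps zero differences on \<open>H\<close> zero, so the rescaled
  functional is orthogonal to the span; it takes the value \<open>2\<close> on both
  diagonals.\<close>

lemma diagonals_not_in_span:
  fixes w :: "real ^ 'n"
  assumes nz: "w $ v1 \<noteq> w $ v2" "w $ v2 \<noteq> w $ v3" "w $ v3 \<noteq> w $ v4" "w $ v4 \<noteq> w $ v1"
  shows "axis v4 1 - axis v2 1 \<notin> span (zero_diffs H (sign_vector E w))"
    and "axis v3 1 - axis v1 1 \<notin> span (zero_diffs H (sign_vector E w))"
proof -
  \<comment> \<open>Scaling the side increments to \<open>1, 1, 1, -3\<close> makes both diagonals nonzero.\<close>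
  define c1 c2 c3 c4 where c: "c1 = 1 / (w $ v2 - w $ v1)" "c2 = 1 / (w $ v3 - w $ v2)"
    "c3 = 1 / (w $ v4 - w $ v3)" "c4 = 1 / (w $ v1 - w $ v4)"
  have cD: "c1 * (w $ v2 - w $ v1) = 1" "c2 * (w $ v3 - w $ v2) = 1" "c3 * (w $ v4 - w $ v3) = 1"
    "c4 * (w $ v1 - w $ v4) = 1"
    using nz by (simp_all add: c)
  have "c1 * (w $ v2 - w $ v1) + c2 * (w $ v3 - w $ v2) + c3 * (w $ v4 - w $ v3)
      + (- 3 * c4) * (w $ v1 - w $ v4) = 0"
    unfolding mult.assoc cD by simp
  then obtain w' :: "real ^ 'n"
    where w1: "\<And>x y. x \<in> P1 \<Longrightarrow> y \<in> P1 \<Longrightarrow> w' $ x - w' $ y = c1 * (w $ x - w $ y)"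
      and w2: "\<And>x y. x \<in> P2 \<Longrightarrow> y \<in> P2 \<Longrightarrow> w' $ x - w' $ y = c2 * (w $ x - w $ y)"
      and w3: "\<And>x y. x \<in> P3 \<Longrightarrow> y \<in> P3 \<Longrightarrow> w' $ x - w' $ y = c3 * (w $ x - w $ y)"
      and w4: "\<And>x y. x \<in> P4 \<Longrightarrow> y \<in> P4 \<Longrightarrow> w' $ x - w' $ y = (- 3 * c4) * (w $ x - w $ y)"
    by (rule rescale) blast
  have "w' $ v2 - w' $ v1 = 1" "w' $ v3 - w' $ v2 = 1" "w' $ v4 - w' $ v3 = 1"
    using w1[OF corners(3,2)] w2[OF corners(5,4)] w3[OF corners(7,6)] unfolding cD by blast+
  then have nonzero: "w' \<bullet> (axis v4 1 - axis v2 1) \<noteq> 0" "w' \<bullet> (axis v3 1 - axis v1 1) \<noteq> 0"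
    by (simp_all add: inner_diff_right inner_axis)
  have "zero_diffs H (sign_vector E w) \<subseteq> {x. w' \<bullet> x = 0}"
  proof
    fix z assume "z \<in> zero_diffs H (sign_vector E w)"
    then obtain u v where uv: "{u, v} \<in> H" "w $ u = w $ v" and z: "z = axis u 1 - axis v 1"
      by (auto simp: zero_diffs_def sign_vector_def sgn_0_0 split: if_splits)
    consider "{u, v} \<subseteq> P1" | "{u, v} \<subseteq> P2" | "{u, v} \<subseteq> P3" | "{u, v} \<subseteq> P4"
      using edges[OF uv(1)] by blast
    then have "w' $ u - w' $ v = 0"
      using w1[of u v] w2[of u v] w3[of u v] w4[of u v] uv(2) by cases simp_all
    then show "z \<in> {x. w' \<bullet> x = 0}"
      by (simp add: z inner_diff_right inner_axis)
  qed
  then have "span (zero_diffs H (sign_vector E w)) \<subseteq> {x. w' \<bullet> x = 0}"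
    by (intro span_minimal subspace_hyperplane)
  with nonzero show "axis v4 1 - axis v2 1 \<notin> span (zero_diffs H (sign_vector E w))"
    "axis v3 1 - axis v1 1 \<notin> span (zero_diffs H (sign_vector E w))"
    by blast+
qed

text \<open>The zeros on \<open>H\<close> agree, so it remains to compare the diagonals. If some
  side increment vanishes, a diagonal of sign \<open>0\<close> already lies in the span; if none
  does, neither diagonal lies in the span and their signs vanish together.\<close>

lemma dim_zero_diffs_flip_sign:
  fixes w :: "real ^ 'n"
  defines "\<sigma> \<equiv> sign_vector E w"
  shows "dim (zero_diffs E' (flip_sign \<sigma>)) = dim (zero_diffs E \<sigma>)"
proof -
  define D1 D2 D3 D4 where D: "D1 = w $ v2 - w $ v1" "D2 = w $ v3 - w $ v2"
    "D3 = w $ v4 - w $ v3" "D4 = w $ v1 - w $ v4"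
  have s: "\<sigma> v2 v1 = sgn D1" "\<sigma> v3 v2 = sgn D2" "\<sigma> v4 v3 = sgn D3" "\<sigma> v1 v4 = sgn D4"
    "\<sigma> v4 v2 = sgn (D2 + D3)"
    by (simp_all add: \<sigma>_def sign_sides D)
  have sum0: "D1 + D2 + D3 + D4 = 0" by (simp add: D)
  let ?A = "zero_diffs H \<sigma>"
  have "flip_sign \<sigma> u v = 0 \<longleftrightarrow> \<sigma> u v = 0" if "{u, v} \<in> H" for u v
    using that by (simp add: flip_sign_def turn_def)
  then have A': "zero_diffs H (flip_sign \<sigma>) = ?A"
    unfolding zero_diffs_def by (intro Collect_cong iff_exI) blast
  have "\<sigma> v4 v2 = 0 \<longleftrightarrow> \<sigma> v2 v4 = 0"
    unfolding \<sigma>_def sign_vector_def insert_commute[of v2 v4] by (auto simp: sgn_0_0)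
  then have dimE: "dim (zero_diffs E \<sigma>) =
      (if \<sigma> v4 v2 = 0 \<and> axis v4 1 - axis v2 1 \<notin> span ?A then dim ?A + 1 else dim ?A)"
    unfolding insert_commute[of v2 v4] by (rule dim_zero_diffs_insert)
  have new: "flip_sign \<sigma> v3 v1 = new_diagonal \<sigma>" "flip_sign \<sigma> v1 v3 = - new_diagonal \<sigma>"
    using diagonals_notin distinct by (auto simp: flip_sign_def insert_commute[of v3 v1])
  then have dimE': "dim (zero_diffs E' (flip_sign \<sigma>)) =
      (if new_diagonal \<sigma> = 0 \<and> axis v3 1 - axis v1 1 \<notin> span ?A then dim ?A + 1 else dim ?A)"
    unfolding insert_commute[of v1 v3] by (subst dim_zero_diffs_insert) (simp_all add: A')
  have "\<sigma> v4 v2 = 0 \<and> axis v4 1 - axis v2 1 \<notin> span ?A \<longleftrightarrow>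
      new_diagonal \<sigma> = 0 \<and> axis v3 1 - axis v1 1 \<notin> span ?A"
  proof (cases "D1 = 0 \<or> D2 = 0 \<or> D3 = 0 \<or> D4 = 0")
    case True
    have base: "axis u 1 - axis v 1 \<in> span ?A" if "{u, v} \<in> H" "\<sigma> u v = 0" for u v
      using that by (auto simp: zero_diffs_def intro: span_base)
    have a: "D1 = 0 \<Longrightarrow> axis v2 1 - axis v1 1 \<in> span ?A" "D2 = 0 \<Longrightarrow> axis v3 1 - axis v2 1 \<in> span ?A"
      "D3 = 0 \<Longrightarrow> axis v4 1 - axis v3 1 \<in> span ?A" "D4 = 0 \<Longrightarrow> axis v1 1 - axis v4 1 \<in> span ?A"
      using sides_swapped by (auto intro!: base simp: s)
    have "axis v4 1 - axis v2 1 \<in> span ?A" if "\<sigma> v4 v2 = 0"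
    proof -
      have "D2 + D3 = 0" using that by (simp add: s sgn_0_0)
      \<comment> \<open>Now also \<open>D1 + D4 = 0\<close>, so a vanishing side brings down its
        partner, and the diagonal is, up to sign, a sum of two zero differences.\<close>
      with True sum0 have "D2 = 0 \<and> D3 = 0 \<or> D1 = 0 \<and> D4 = 0" by auto
      then show ?thesis
        using a span_add[of "axis v4 1 - axis v3 1" ?A "axis v3 1 - axis v2 1"]
          span_neg[OF span_add[of "axis v2 1 - axis v1 1" ?A "axis v1 1 - axis v4 1"]] by auto
    qed
    moreover have "axis v3 1 - axis v1 1 \<in> span ?A" if "new_diagonal \<sigma> = 0"
    proof -
      have "sgn D2 = - sgn D1 \<and> sgn D4 = - sgn D3"
        using new_diagonal_eq_0_if_side_0[of \<sigma>] that True unfolding s sgn_0_0 by blast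
      then have "D1 = 0 \<longleftrightarrow> D2 = 0" "D3 = 0 \<longleftrightarrow> D4 = 0"
        by (metis neg_equal_0_iff_equal sgn_0_0)+
      with True have "D1 = 0 \<and> D2 = 0 \<or> D3 = 0 \<and> D4 = 0" by blast
      then show ?thesis
        using a span_add[of "axis v3 1 - axis v2 1" ?A "axis v2 1 - axis v1 1"]
          span_neg[OF span_add[of "axis v4 1 - axis v3 1" ?A "axis v1 1 - axis v4 1"]] by auto
    qed
    ultimately show ?thesis by blast
  next
    case False
    then have "axis v4 1 - axis v2 1 \<notin> span ?A" "axis v3 1 - axis v1 1 \<notin> span ?A"
      unfolding \<sigma>_def by (intro diagonals_not_in_span; simp add: D)+
    moreover have "\<sigma> v4 v2 = 0 \<longleftrightarrow> new_diagonal \<sigma> = 0"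
    proof
      have signs: "\<sigma> v2 v1 \<in> {-1, 1}" "\<sigma> v3 v2 \<in> {-1, 1}" "\<sigma> v4 v3 \<in> {-1, 1}" "\<sigma> v1 v4 \<in> {-1, 1}"
        using False unfolding s by (simp_all add: sgn_if)
      then show "\<sigma> v4 v2 = 0" if "new_diagonal \<sigma> = 0"
        using that by (rule new_diagonal_eq_0)
      assume 0: "\<sigma> v4 v2 = 0"
      then have "D3 = - D2" "D4 = - D1"
        using sum0 by (simp_all add: s sgn_0_0)
      then have "\<sigma> v4 v3 = - \<sigma> v3 v2" "\<sigma> v1 v4 = - \<sigma> v2 v1"
        unfolding s by (simp_all add: sgn_minus)
      with signs 0 show "new_diagonal \<sigma> = 0" by (simp add: new_diagonal_free)
    qed
    ultimately show ?thesis by simp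
  qed
  then show ?thesis unfolding dimE dimE' by simp
qed

section \<open>Comparison of the face vectors\<close>

lemma card_covectors_le: "card (covectors E k) \<le> card (covectors E' k)"
proof (rule card_inj_on_le)
  show "inj_on flip_sign (covectors E k)"
    by (rule inj_on_subset[OF flip_sign_inj]) (auto simp: covectors_def)
  show "flip_sign ` covectors E k \<subseteq> covectors E' k"
    using flip_sign_covector dim_zero_diffs_flip_sign by (auto simp: covectors_def)
  show "finite (covectors E' k)"
    by (rule finite_covectors)
qed

lemma card_covectors_eq: "card (covectors E k) = card (covectors E' k)"
  using card_covectors_le[of k]
    flip_square.card_covectors_le[OF rotate, of k, unfolded insert_commute[of v3 v1]]
  by (rule order_antisym)

text \<open>The map fixes the zero sign vector, whose face is the whole zonotope; hence the two face
  vectors have the same length.\<close>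

lemma dim_zero_diffs_flip: "dim (zero_diffs E (sign_vector E 0)) = dim (zero_diffs E' (sign_vector E' 0))"
proof -
  have zero: "sign_vector F 0 = (\<lambda>u v. 0)" for F :: "'n set set"
    by (intro ext) (simp only: sign_vector_def zero_index diff_zero sgn_zero if_cancel)
  have "new_diagonal (\<lambda>u v. 0) = 0"
    by (simp only: new_diagonal_def Let_def antipodal_def sgn_zero) simp
  then have "flip_sign (\<lambda>u v. 0) = (\<lambda>u v. 0)"
    unfolding flip_sign_def by (simp only: mult_zero_right minus_zero if_cancel)
  then have "flip_sign (sign_vector E 0) = sign_vector E' 0"
    unfolding zero .
  then show ?thesis
    using dim_zero_diffs_flip_sign[of 0] by (simp only:)
qed

lemma face_vector_flip:
  "face_vector (graphical_zonotope E) = face_vector (graphical_zonotope E')"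
proof -
  have "simple_graph E" "simple_graph E'"
    using edges distinct by (auto simp: simple_graph_def)
  then show ?thesis
    unfolding face_vector_def
    by (simp add: card_faces_zonotope card_covectors_eq aff_dim_zonotope dim_zero_diffs_flip)
qed

end

text \<open>The pieces are the sets \<open>V i\<close> enlarged by the ends of the corresponding
  side, and \<open>H\<close> is the graph without its old diagonal.\<close>

lemma flip_face_vector:
  assumes "flip G G'"
  shows "face_vector (graphical_zonotope G) = face_vector (graphical_zonotope G')"
proof -
  obtain v :: "nat \<Rightarrow> 'a" and V :: "nat \<Rightarrow> 'a set"
    where G: "simple_graph G" and v: "inj_on v {1..4}" "v 5 = v 1"
      and induced: "{e \<in> G. e \<subseteq> v ` {1..4}} =
          {{v 1, v 2}, {v 2, v 3}, {v 3, v 4}, {v 4, v 1}, {v 2, v 4}}"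
      and V: "disjoint_family_on V {1..4}" "(\<Union>i\<in>{1..4}. V i) = UNIV - v ` {1..4}"
      and edge: "\<And>e. e \<in> G \<Longrightarrow> e \<noteq> {v 2, v 4} \<Longrightarrow> \<exists>i\<in>{1..4}. e \<subseteq> V i \<union> {v i, v (i + 1)}"
      and G': "G' = insert {v 1, v 3} (G - {{v 2, v 4}})"
    using assms unfolding flip_def by blast
  have four: "{1..4::nat} = {1, 2, 3, 4}" by auto
  have ne: "v i \<noteq> v j" if "i \<in> {1, 2, 3, 4}" "j \<in> {1, 2, 3, 4}" "i \<noteq> j" for i j
    using v(1) that unfolding four by (metis inj_onD)
  have dist: "distinct [v 1, v 2, v 3, v 4]"
    using ne[of 1 2] ne[of 1 3] ne[of 1 4] ne[of 2 3] ne[of 2 4] ne[of 3 4] by simp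
  define H where "H = G - {{v 2, v 4}}"
  have inG: "{{v 1, v 2}, {v 2, v 3}, {v 3, v 4}, {v 4, v 1}, {v 2, v 4}} \<subseteq> G"
    unfolding induced[symmetric] by blast
  have vV: "v i \<notin> V j" if "i \<in> {1..4}" "j \<in> {1..4}" for i j
    using V(2) that by blast
  have disj: "V i \<inter> V j = {}" if "i \<in> {1..4}" "j \<in> {1..4}" "i \<noteq> j" for i j
    using V(1) that unfolding disjoint_family_on_def by blast
  interpret flip_square H "v 1" "v 2" "v 3" "v 4" "V 1 \<union> {v 1, v 2}" "V 2 \<union> {v 2, v 3}"
    "V 3 \<union> {v 3, v 4}" "V 4 \<union> {v 4, v 1}"
  proof
    show "distinct [v 1, v 2, v 3, v 4]" by (fact dist)
    show "{v 1, v 2} \<in> H" "{v 2, v 3} \<in> H" "{v 3, v 4} \<in> H" "{v 4, v 1} \<in> H"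
      using inG dist by (auto simp: H_def doubleton_eq_iff)
    show "card e = 2 \<and> (e \<subseteq> V 1 \<union> {v 1, v 2} \<or> e \<subseteq> V 2 \<union> {v 2, v 3} \<or> e \<subseteq> V 3 \<union> {v 3, v 4}
        \<or> e \<subseteq> V 4 \<union> {v 4, v 1})" if "e \<in> H" for e
    proof -
      have "e \<in> G" "e \<noteq> {v 2, v 4}" using that by (auto simp: H_def)
      then obtain i where i: "i \<in> {1, 2, 3, 4}" and sub: "e \<subseteq> V i \<union> {v i, v (i + 1)}"
        using edge four by metis
      \<comment> \<open>For \<open>i = 4\<close> the successor is \<open>5\<close>, and
        \<open>v 5 = v 1\<close> closes the cycle.\<close>
      have next_index: "(1::nat) + 1 = 2" "(2::nat) + 1 = 3" "(3::nat) + 1 = 4" "(4::nat) + 1 = 5"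
        by simp_all
      from i have "i = 1 \<or> i = 2 \<or> i = 3 \<or> i = 4" by blast
      then have "e \<subseteq> V 1 \<union> {v 1, v 2} \<or> e \<subseteq> V 2 \<union> {v 2, v 3} \<or> e \<subseteq> V 3 \<union> {v 3, v 4}
        \<or> e \<subseteq> V 4 \<union> {v 4, v 1}"
        using sub next_index v(2) by metis
      moreover have "card e = 2" using G \<open>e \<in> G\<close> by (simp add: simple_graph_def)
      ultimately show ?thesis by blast
    qed
  qed (use dist disj[of 1 2] disj[of 2 3] disj[of 3 4] disj[of 4 1] disj[of 1 3] disj[of 2 4]
      vV[of 1] vV[of 2] vV[of 3] vV[of 4] in auto)
  have "G = insert {v 2, v 4} H" "G' = insert {v 1, v 3} H"
    using inG by (auto simp: H_def G')
  then show ?thesis using face_vector_flip by simp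
qed

theorem theorem2p1:
  fixes G G' :: "'n::finite set set"
  assumes "simple_graph G" and "connected_graph G"
    and "simple_graph G'" and "connected_graph G'"
    and "flip_equivalent G G'"
  shows "face_vector (graphical_zonotope G) = face_vector (graphical_zonotope G')"
  using assms(5) unfolding flip_equivalent_def
  by (induction rule: rtranclp_induct) (auto dest: flip_face_vector)

end
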